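(* Let $k\ge 1$ be a fixed integer, and let $x_0,x_1,x_2,\ldots$ be i.i.d. random variables uniformly distributed on $\{1,\ldots,k\}$. For $n\ge 2$ let $P_n=\sum_{i=1}^{n-1}|x_i-x_{i-1}|+x_0+x_{n-1}+2n$ be the perimeter of the word $x_0x_1\cdots x_{n-1}$, and let $\mu_3(P_n)=\mathbb{E}\left[(P_n-\mathbb{E}P_n)^3\right]$. Then, as $n\to\infty$, $$\mu_3(P_n)=n\mu_3^*+\mathcal{O}(1),$$ where $$\mu_3^*=(T_{0,3}+3T_{0,1,2}+6T_{0,1,1,1}+3T_{0,2,1})+(-9T_{0,2}-24T_{0,1,1}-6M^2)M+26M^3=\frac{4(k-2)(1+2k)(2k-1)(k+2)(k-1)(k+1)}{945k^3}.$$
   Context: Write $y_i:=|x_i-x_{i-1}|$ for $i\ge 1$, and define $M:=\mathbb{E}(y_1)$, $T_{0,2}:=\mathbb{E}(y_1^2)$, $T_{0,3}:=\mathbb{E}(y_1^3)$, $T_{0,1,1}:=\mathbb{E}(y_1y_2)$, $T_{0,1,2}:=\mathbb{E}(y_1y_2^2)$, $T_{0,2,1}:=\mathbb{E}(y_1^2y_2)$, $T_{0,1,1,1}:=\mathbb{E}(y_1y_2y_3)$. The quantity $P_n$ is the number of boundary edges of the word of $n$ letters seen as a polyomino (bar graph) whose consecutive columns have heights $x_0,\ldots,x_{n-1}$. The constant implied in $\mathcal{O}(1)$ may depend on $k$ but not on $n$. *)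

theory Defs
  imports "HOL-Probability.Probability" "HOL-Library.Landau_Symbols"
begin

(* The letters are integer valued so that the differences below do not truncate.
   The step |x_i - x_{i-1}| is only meaningful for i >= 1. *)
definition step :: "(nat \<Rightarrow> 'a \<Rightarrow> int) \<Rightarrow> nat \<Rightarrow> 'a \<Rightarrow> int" where
  "step x i \<omega> = \<bar>x i \<omega> - x (i - 1) \<omega>\<bar>"

(* P_n for the word x_0 ... x_{n-1}; only meaningful for n >= 1 *)
definition perimeter :: "(nat \<Rightarrow> 'a \<Rightarrow> int) \<Rightarrow> nat \<Rightarrow> 'a \<Rightarrow> int" where
  "perimeter x n \<omega> =
     (\<Sum>i = 1..n - 1. step x i \<omega>) + x 0 \<omega> + x (n - 1) \<omega> + 2 * int n"

definition third_central_moment :: "'a measure \<Rightarrow> ('a \<Rightarrow> int) \<Rightarrow> real" where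
  "third_central_moment \<Omega> X =
     prob_space.expectation \<Omega>
       (\<lambda>\<omega>. (real_of_int (X \<omega>) - prob_space.expectation \<Omega> (\<lambda>\<omega>. real_of_int (X \<omega>))) ^ 3)"

definition mu3_star :: "'a measure \<Rightarrow> (nat \<Rightarrow> 'a \<Rightarrow> int) \<Rightarrow> real" where
  "mu3_star \<Omega> x =
     (let E = prob_space.expectation \<Omega>;
          y = (\<lambda>i \<omega>. real_of_int (step x i \<omega>));
          M = E (y 1);
          T02 = E (\<lambda>\<omega>. y 1 \<omega> ^ 2);
          T03 = E (\<lambda>\<omega>. y 1 \<omega> ^ 3);
          T011 = E (\<lambda>\<omega>. y 1 \<omega> * y 2 \<omega>);
          T012 = E (\<lambda>\<omega>. y 1 \<omega> * y 2 \<omega> ^ 2);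
          T021 = E (\<lambda>\<omega>. y 1 \<omega> ^ 2 * y 2 \<omega>);
          T0111 = E (\<lambda>\<omega>. y 1 \<omega> * y 2 \<omega> * y 3 \<omega>)
      in (T03 + 3 * T012 + 6 * T0111 + 3 * T021)
         + (- 9 * T02 - 24 * T011 - 6 * M ^ 2) * M + 26 * M ^ 3)"

end

(* The steps y_i = |x_i - x_{i-1}| form a stationary 1-dependent sequence. With S_n the centred
   sum of x_0 and y_1, ..., y_n, and v a centred function of x_n and x_{n+1}, expand E[(S_n + v)^3]
   and peel the most recent steps off S_n: by independence of past and future only moments of at
   most four consecutive letters survive, so E[(S_n + v)^3] - E[S_n^3] does not depend on n >= 2.
   Taking v to be the next centred step, and v = x_n - E x_n for the boundary term, the third
   central moment is exactly affine in n for n >= 3, with slope mu_3^*. The closed form of the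
   slope follows since sum_a |a - b| and its iterates are polynomials in b and k. *)
theory Submission
  imports Defs
begin

section \<open>Power sums and sums of absolute differences\<close>

lemma sum_powers:
  shows "(\<Sum>a=1..n. real a) = real n * (real n + 1) / 2"
    and "(\<Sum>a=1..n. real a ^ 2) = real n * (real n + 1) * (2 * real n + 1) / 6"
    and "(\<Sum>a=1..n. real a ^ 3) = real n ^ 2 * (real n + 1) ^ 2 / 4"
    and "(\<Sum>a=1..n. real a ^ 4) = real n ^ 5 / 5 + real n ^ 4 / 2 + real n ^ 3 / 3 - real n / 30"
    and "(\<Sum>a=1..n. real a ^ 5) = real n ^ 6 / 6 + real n ^ 5 / 2 + 5 * real n ^ 4 / 12 - real n ^ 2 / 12"
    and "(\<Sum>a=1..n. real a ^ 6) = real n ^ 7 / 7 + real n ^ 6 / 2 + real n ^ 5 / 2 - real n ^ 3 / 6 + real n / 42"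
  by (induct n; simp add: field_simps power_numeral_reduce)+

text \<open>For a \<le> b the distance equals (a - b) + 2 (b - a), and beyond b it is a - b. Only
  the correction term depends on the sign, and it lives on 1..b. For polynomial f both sums on the
  right are then power sums.\<close>

lemma sum_abs_diff_mult:
  fixes f :: "nat \<Rightarrow> real"
  assumes "b \<le> k"
  shows "(\<Sum>a=1..k. \<bar>real b - real a\<bar> * f a)
    = (\<Sum>a=1..k. (real a - real b) * f a) + 2 * (\<Sum>a=1..b. (real b - real a) * f a)"
proof -
  have "(\<Sum>a=1..k. \<bar>real b - real a\<bar> * f a) - (\<Sum>a=1..k. (real a - real b) * f a)
      = (\<Sum>a=1..k. if a \<le> b then 2 * ((real b - real a) * f a) else 0)"
    unfolding sum_subtractf[symmetric] by (intro sum.cong) (auto simp: algebra_simps)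
  also have "\<dots> = (\<Sum>a | a \<in> {1..k} \<and> a \<le> b. 2 * ((real b - real a) * f a))"
    by (intro sum.inter_filter[symmetric]) simp
  also have "{a. a \<in> {1..k} \<and> a \<le> b} = {1..b}"
    using assms by auto
  finally show ?thesis
    by (simp add: sum_distrib_left)
qed

text \<open>The total distance from b to the letters 1..k, as a polynomial in b.\<close>

definition dev1 :: "nat \<Rightarrow> real \<Rightarrow> real" where
  "dev1 k b = b ^ 2 - (real k + 1) * b + (real k + real k ^ 2) / 2"

lemma sum_dev1:
  assumes "b \<le> k"
  shows "(\<Sum>a=1..k. \<bar>real b - real a\<bar>) = dev1 k (real b)"
  using sum_abs_diff_mult[OF assms, of "\<lambda>_. 1"]
  by (simp add: sum_subtractf sum_powers dev1_def field_simps power2_eq_square del: One_nat_def)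

lemma sum_dev2:
  "(\<Sum>a=1..k. \<bar>real b - real a\<bar> ^ 2)
    = real k * real b ^ 2 - real k * (real k + 1) * real b + real k * (real k + 1) * (2 * real k + 1) / 6"
proof -
  have "(\<Sum>a=1..k. \<bar>real b - real a\<bar> ^ 2) = (\<Sum>a=1..k. real b ^ 2 - 2 * real b * real a + real a ^ 2)"
    by (intro sum.cong refl) (simp add: power2_diff)
  then show ?thesis
    by (simp add: sum_subtractf sum.distrib sum_powers del: One_nat_def flip: sum_distrib_left)
qed

lemma sum_dev3:
  assumes "b \<le> k"
  shows "(\<Sum>a=1..k. \<bar>real b - real a\<bar> ^ 3)
    = real b ^ 4 / 2 - (real k + 1) * real b ^ 3 + (1 + 3 * real k + 3 * real k ^ 2) / 2 * real b ^ 2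
      - (real k + 3 * real k ^ 2 + 2 * real k ^ 3) / 2 * real b + real k ^ 2 * (real k + 1) ^ 2 / 4"
proof -
  \<comment> \<open>Two of the three absolute values form a square, so
    \<open>sum_abs_diff_mult\<close> applies with a quadratic weight.\<close>
  have "(\<Sum>a=1..k. \<bar>real b - real a\<bar> ^ 3) = (\<Sum>a=1..k. \<bar>real b - real a\<bar> * (real b - real a) ^ 2)"
    by (simp add: power3_eq_cube power2_eq_square mult_ac)
  also have "\<dots> = (\<Sum>a=1..k. real a ^ 3 - 3 * real b * real a ^ 2 + 3 * real b ^ 2 * real a - real b ^ 3)
     + 2 * (\<Sum>a=1..b. real b ^ 3 - 3 * real b ^ 2 * real a + 3 * real b * real a ^ 2 - real a ^ 3)"
    unfolding sum_abs_diff_mult[OF assms]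
    by (intro arg_cong2[where f="(+)"] arg_cong2[where f="(*)"] sum.cong refl) algebra+
  also have "\<dots> = real b ^ 4 / 2 - (real k + 1) * real b ^ 3 + (1 + 3 * real k + 3 * real k ^ 2) / 2 * real b ^ 2
      - (real k + 3 * real k ^ 2 + 2 * real k ^ 3) / 2 * real b + real k ^ 2 * (real k + 1) ^ 2 / 4"
    by (simp add: sum_subtractf sum.distrib sum_powers del: One_nat_def flip: sum_distrib_left)
      (simp add: field_simps power_numeral_reduce)
  finally show ?thesis .
qed

text \<open>The second iterate, on the constant 1, of the operator sending f to b \<mapsto> sum_a |b
  - a| f(a). It evaluates two successive steps out of a fixed letter b, as needed for products of
  three steps.\<close>

lemma sum_dev1_dev1:
  assumes "b \<le> k"
  shows "(\<Sum>a=1..k. \<bar>real b - real a\<bar> * dev1 k (real a))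
    = (real b ^ 4 - 2 * (real k + 1) * real b ^ 3 + (3 * real k ^ 2 + 3 * real k - 1) * real b ^ 2
       + (2 + real k - 3 * real k ^ 2 - 2 * real k ^ 3) * real b
       + (real k ^ 4 + real k ^ 3 - real k ^ 2 - real k)) / 6"
proof -
  \<comment> \<open>The coefficients of \<open>dev1\<close> stay opaque while the summand is sorted
    by powers of a and the power sums are inserted; they are unfolded only at the end.\<close>
  define K where "K = (real k + real k ^ 2) / 2"
  define c where "c = real k + 1"
  have "(\<Sum>a=1..k. \<bar>real b - real a\<bar> * dev1 k (real a))
     = (\<Sum>a=1..k. real a ^ 3 - (c + real b) * real a ^ 2 + (K + c * real b) * real a - K * real b)
     + 2 * (\<Sum>a=1..b. K * real b - (K + c * real b) * real a + (c + real b) * real a ^ 2 - real a ^ 3)"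
    unfolding sum_abs_diff_mult[OF assms] dev1_def K_def[symmetric] c_def[symmetric]
    by (intro arg_cong2[where f="(+)"] arg_cong2[where f="(*)"] sum.cong refl) algebra+
  then show ?thesis
    by (simp add: sum_subtractf sum.distrib sum_powers del: One_nat_def flip: sum_distrib_left)
      (simp add: K_def c_def field_simps power_numeral_reduce)
qed

text \<open>Two adjacent steps share only the middle letter; once it is fixed the sum
  factors.\<close>

lemma sum_path2:
  fixes f g :: "'b \<Rightarrow> 'b \<Rightarrow> real"
  shows "(\<Sum>a\<in>A. \<Sum>b\<in>A. \<Sum>c\<in>A. f a b * g b c) = (\<Sum>b\<in>A. (\<Sum>a\<in>A. f a b) * (\<Sum>c\<in>A. g b c))"
  by (subst sum.swap) (simp add: sum_product)

lemma sum_path3: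
  fixes f g h :: "'b \<Rightarrow> 'b \<Rightarrow> real"
  shows "(\<Sum>a\<in>A. \<Sum>b\<in>A. \<Sum>c\<in>A. \<Sum>d\<in>A. f a b * g b c * h c d)
    = (\<Sum>b\<in>A. (\<Sum>a\<in>A. f a b) * (\<Sum>c\<in>A. g b c * (\<Sum>d\<in>A. h c d)))"
  using sum_path2[of f "\<lambda>b c. g b c * (\<Sum>d\<in>A. h c d)" A]
  by (simp add: sum_distrib_left mult.assoc)

section \<open>Averages over four letters\<close>

text \<open>Products of three consecutive steps involve four letters. Shorter products ignore
  trailing arguments, so a single linear functional serves all moments. The sums run over naturals
  to fit the power sums, while the letters are integers.\<close>

definition avg4 :: "nat \<Rightarrow> (int \<Rightarrow> int \<Rightarrow> int \<Rightarrow> int \<Rightarrow> real) \<Rightarrow> real" where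
  "avg4 k F = (\<Sum>a=1..k. \<Sum>b=1..k. \<Sum>c=1..k. \<Sum>d=1..k. F (int a) (int b) (int c) (int d)) / real k ^ 4"

lemma avg4_add: "avg4 k (\<lambda>a b c d. F a b c d + G a b c d) = avg4 k F + avg4 k G"
  by (simp add: avg4_def sum.distrib add_divide_distrib)

lemma avg4_diff: "avg4 k (\<lambda>a b c d. F a b c d - G a b c d) = avg4 k F - avg4 k G"
  by (simp add: avg4_def sum_subtractf diff_divide_distrib)

lemma avg4_cmult: "avg4 k (\<lambda>a b c d. r * F a b c d) = r * avg4 k F"
  by (simp add: avg4_def flip: sum_distrib_left)

lemma avg4_const: "k \<ge> 1 \<Longrightarrow> avg4 k (\<lambda>a b c d. r) = r"
  by (simp add: avg4_def power4_eq_xxxx)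

text \<open>Stationarity in finite form: the idle letter contributes a factor k whether it comes
  first or last.\<close>

lemma avg4_shift: "avg4 k (\<lambda>a b c d. F b c d) = avg4 k (\<lambda>a b c d. F a b c)"
  by (simp add: avg4_def flip: sum_distrib_left)

text \<open>Serves to write a function of four letters as a combination of indicators of
  words.\<close>

lemma sum4_delta:
  fixes F :: "'b \<Rightarrow> 'b \<Rightarrow> 'b \<Rightarrow> 'b \<Rightarrow> real"
  assumes "finite A" "p \<in> A" "q \<in> A" "r \<in> A" "s \<in> A"
  shows "(\<Sum>a\<in>A. \<Sum>b\<in>A. \<Sum>c\<in>A. \<Sum>d\<in>A. F a b c d * of_bool (p = a \<and> q = b \<and> r = c \<and> s = d)) = F p q r s"
proof -
  have "(\<Sum>a\<in>A. \<Sum>b\<in>A. \<Sum>c\<in>A. \<Sum>d\<in>A. F a b c d * of_bool (p = a \<and> q = b \<and> r = c \<and> s = d))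
     = (\<Sum>a\<in>A. if p = a then \<Sum>b\<in>A. if q = b then \<Sum>c\<in>A. if r = c then \<Sum>d\<in>A. if s = d then F a b c d else 0 else 0 else 0 else 0)"
    by (intro sum.cong refl) (auto intro!: sum.cong)
  also have "\<dots> = F p q r s"
    using assms by simp
  finally show ?thesis .
qed

section \<open>Closed forms for moments of up to three consecutive steps\<close>

abbreviation dist_letters :: "int \<Rightarrow> int \<Rightarrow> real" where
  "dist_letters a b \<equiv> real_of_int \<bar>b - a\<bar>"

lemma sum_dev1':
  assumes "b \<le> k"
  shows "(\<Sum>a=1..k. \<bar>real a - real b\<bar>) = dev1 k (real b)"
  using sum_dev1[OF assms] by (simp add: abs_minus_commute)

lemma avg4_step:
  assumes "k \<ge> 1"
  shows "avg4 k (\<lambda>a b c d. dist_letters a b) = (real k ^ 2 - 1) / (3 * real k)"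
proof -
  have "(\<Sum>a=1..k. \<Sum>b=1..k. \<bar>real b - real a\<bar>) = (\<Sum>a=1..k. dev1 k (real a))"
    by (intro sum.cong refl sum_dev1') auto
  then show ?thesis
    using assms
    by (simp add: avg4_def dev1_def sum.distrib sum_subtractf sum_powers del: One_nat_def flip: sum_distrib_left)
      (simp add: field_simps power_numeral_reduce)
qed

lemma avg4_step_power2:
  assumes "k \<ge> 1"
  shows "avg4 k (\<lambda>a b c d. dist_letters a b ^ 2) = (real k ^ 2 - 1) / 6"
proof -
  have "(\<Sum>a=1..k. \<Sum>b=1..k. \<bar>real b - real a\<bar> ^ 2)
      = (\<Sum>a=1..k. real k * real a ^ 2 - real k * (real k + 1) * real a + real k * (real k + 1) * (2 * real k + 1) / 6)"
    by (simp only: sum_dev2[symmetric] abs_minus_commute)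
  then show ?thesis
    using assms
    by (simp add: avg4_def sum.distrib sum_subtractf sum_powers del: One_nat_def power2_abs flip: sum_distrib_left)
      (simp add: field_simps power_numeral_reduce)
qed

lemma avg4_step_power3:
  assumes "k \<ge> 1"
  shows "avg4 k (\<lambda>a b c d. dist_letters a b ^ 3) = (3 * real k ^ 4 - 5 * real k ^ 2 + 2) / (30 * real k)"
proof -
  have "(\<Sum>a=1..k. \<Sum>b=1..k. \<bar>real b - real a\<bar> ^ 3)
      = (\<Sum>a=1..k. 1 / 2 * real a ^ 4 - (real k + 1) * real a ^ 3 + (1 + 3 * real k + 3 * real k ^ 2) / 2 * real a ^ 2
      - (real k + 3 * real k ^ 2 + 2 * real k ^ 3) / 2 * real a + real k ^ 2 * (real k + 1) ^ 2 / 4)"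
    using sum_dev3 by (intro sum.cong refl) (simp add: abs_minus_commute)
  then show ?thesis
    using assms
    by (simp add: avg4_def sum.distrib sum_subtractf sum_powers del: One_nat_def flip: sum_distrib_left sum_divide_distrib)
      (simp add: field_simps power_numeral_reduce)
qed

lemma avg4_step_step:
  assumes "k \<ge> 1"
  shows "avg4 k (\<lambda>a b c d. dist_letters a b * dist_letters b c) = (7 * real k ^ 4 - 15 * real k ^ 2 + 8) / (60 * real k ^ 2)"
proof -
  define K where "K = (real k + real k ^ 2) / 2"
  define c where "c = real k + 1"
  have "(\<Sum>a=1..k. \<Sum>b=1..k. \<Sum>c=1..k. \<bar>real b - real a\<bar> * \<bar>real c - real b\<bar>)
      = (\<Sum>b=1..k. dev1 k (real b) * dev1 k (real b))"
    unfolding sum_path2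
    by (intro sum.cong refl arg_cong2[where f="(*)"] sum_dev1 sum_dev1') auto
  also have "\<dots> = (\<Sum>b=1..k. real b ^ 4 - 2 * c * real b ^ 3 + (c ^ 2 + 2 * K) * real b ^ 2 - 2 * c * K * real b + K ^ 2)"
    unfolding dev1_def c_def[symmetric] K_def[symmetric] by (intro sum.cong refl) algebra
  finally show ?thesis
    using assms
    by (simp add: avg4_def sum.distrib sum_subtractf sum_powers del: One_nat_def flip: sum_distrib_left)
      (simp add: K_def c_def field_simps power_numeral_reduce)
qed

text \<open>Fixing the middle letter turns both averages into the same sum over b, of
  \<open>dev1\<close> times the quadratic from \<open>sum_dev2\<close>; they differ only in the
  order of the factors.\<close>

lemma avg4_step_step2:
  assumes "k \<ge> 1"
  shows "avg4 k (\<lambda>a b c d. dist_letters a b * dist_letters b c ^ 2)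
    = (11 * real k ^ 4 - 25 * real k ^ 2 + 14) / (180 * real k)"
    and "avg4 k (\<lambda>a b c d. dist_letters a b ^ 2 * dist_letters b c)
    = (11 * real k ^ 4 - 25 * real k ^ 2 + 14) / (180 * real k)"
proof -
  define K where "K = (real k + real k ^ 2) / 2"
  define c where "c = real k + 1"
  define q where "q = real k * (real k + 1) * (2 * real k + 1) / 6"
  let ?q = "\<lambda>b. real k * real b ^ 2 - real k * (real k + 1) * real b + real k * (real k + 1) * (2 * real k + 1) / 6"
  have dev2': "(\<Sum>c=1..k. \<bar>real c - real b\<bar> ^ 2) = ?q b" for b
    by (simp only: sum_dev2[symmetric] abs_minus_commute)
  have 1: "(\<Sum>a=1..k. \<Sum>b=1..k. \<Sum>c=1..k. \<bar>real b - real a\<bar> * \<bar>real c - real b\<bar> ^ 2)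
      = (\<Sum>b=1..k. dev1 k (real b) * ?q b)"
    unfolding sum_path2
    by (intro sum.cong refl arg_cong2[where f="(*)"] sum_dev1 dev2') auto
  have 2: "(\<Sum>a=1..k. \<Sum>b=1..k. \<Sum>c=1..k. \<bar>real b - real a\<bar> ^ 2 * \<bar>real c - real b\<bar>)
      = (\<Sum>b=1..k. ?q b * dev1 k (real b))"
    unfolding sum_path2
    by (intro sum.cong refl arg_cong2[where f="(*)"] sum_dev2 sum_dev1') auto
  have 3: "(\<Sum>b=1..k. dev1 k (real b) * ?q b)
     = (\<Sum>b=1..k. real k * real b ^ 4 - 2 * real k * c * real b ^ 3 + (q + real k * c ^ 2 + real k * K) * real b ^ 2
          - (c * q + K * real k * c) * real b + K * q)"
    by (intro sum.cong refl) (simp add: dev1_def c_def K_def q_def field_simps power_numeral_reduce)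
  have 4: "(\<Sum>b=1..k. dev1 k (real b) * ?q b) / real k ^ 3 = (11 * real k ^ 4 - 25 * real k ^ 2 + 14) / (180 * real k)"
    unfolding 3 using assms
    by (simp add: sum.distrib sum_subtractf sum_powers del: One_nat_def flip: sum_distrib_left)
      (simp add: K_def c_def q_def field_simps power_numeral_reduce)
  show "avg4 k (\<lambda>a b c d. dist_letters a b * dist_letters b c ^ 2)
    = (11 * real k ^ 4 - 25 * real k ^ 2 + 14) / (180 * real k)"
    using 1 4 assms
    by (simp add: avg4_def power_numeral_reduce del: One_nat_def power2_abs flip: sum_distrib_left)
  show "avg4 k (\<lambda>a b c d. dist_letters a b ^ 2 * dist_letters b c)
    = (11 * real k ^ 4 - 25 * real k ^ 2 + 14) / (180 * real k)"
    using 2 4 assms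
    by (simp add: avg4_def power_numeral_reduce mult.commute del: One_nat_def power2_abs flip: sum_distrib_left)
qed

lemma avg4_step_step_step:
  assumes "k \<ge> 1"
  shows "avg4 k (\<lambda>a b c d. dist_letters a b * dist_letters b c * dist_letters c d)
    = (17 * real k ^ 6 - 56 * real k ^ 4 + 63 * real k ^ 2 - 24) / (420 * real k ^ 3)"
proof -
  \<comment> \<open>\<open>K\<close> and \<open>c\<close> are the coefficients of
    \<open>dev1\<close>; \<open>q\<close>, \<open>l\<close> and \<open>t\<close> are those of the
    quartic in \<open>sum_dev1_dev1\<close>.\<close>
  define K where "K = (real k + real k ^ 2) / 2"
  define c where "c = real k + 1"
  define q where "q = 3 * real k ^ 2 + 3 * real k - 1"
  define l where "l = 2 + real k - 3 * real k ^ 2 - 2 * real k ^ 3"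
  define t where "t = real k ^ 4 + real k ^ 3 - real k ^ 2 - real k"
  have inner: "(\<Sum>c=1..k. \<bar>real c - real b\<bar> * (\<Sum>d=1..k. \<bar>real d - real c\<bar>))
      = (real b ^ 4 - 2 * c * real b ^ 3 + q * real b ^ 2 + l * real b + t) / 6" if "b \<le> k" for b
  proof -
    have "(\<Sum>c=1..k. \<bar>real c - real b\<bar> * (\<Sum>d=1..k. \<bar>real d - real c\<bar>)) = (\<Sum>c=1..k. \<bar>real b - real c\<bar> * dev1 k (real c))"
      by (intro sum.cong refl arg_cong2[where f="(*)"] sum_dev1' abs_minus_commute) auto
    then show ?thesis
      by (simp add: sum_dev1_dev1[OF that] c_def q_def l_def t_def del: One_nat_def)
  qed
  have "(\<Sum>a=1..k. \<Sum>b=1..k. \<Sum>c=1..k. \<Sum>d=1..k. \<bar>real b - real a\<bar> * \<bar>real c - real b\<bar> * \<bar>real d - real c\<bar>)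
      = (\<Sum>b=1..k. dev1 k (real b) * ((real b ^ 4 - 2 * c * real b ^ 3 + q * real b ^ 2 + l * real b + t) / 6))"
    unfolding sum_path3
    by (intro sum.cong refl arg_cong2[where f="(*)"] sum_dev1 inner) auto
  also have "\<dots> = (\<Sum>b=1..k. real b ^ 6 - 3 * c * real b ^ 5 + (q + 2 * c ^ 2 + K) * real b ^ 4
       + (l - c * q - 2 * c * K) * real b ^ 3 + (t - c * l + K * q) * real b ^ 2 + (K * l - c * t) * real b + K * t) / 6"
    unfolding dev1_def c_def[symmetric] K_def[symmetric] sum_divide_distrib
    by (intro sum.cong refl) (simp add: field_simps power_numeral_reduce)
  finally show ?thesis
    using assms
    by (simp add: avg4_def sum.distrib sum_subtractf sum_powers del: One_nat_def flip: sum_distrib_left)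
      (simp add: K_def c_def q_def l_def t_def field_simps power_numeral_reduce)
qed

text \<open>The rational identity left once all averages in the slope have their closed forms. The
  mean step stays a variable \<open>m\<close> on the left so that the expression matches
  \<open>mu3_star_avg4\<close> after that substitution.\<close>

lemma mu3_closed_form:
  assumes "k \<ge> 1" and "m = (real k ^ 2 - 1) / (3 * real k)"
  shows "((3 * real k ^ 4 - 5 * real k ^ 2 + 2) / (30 * real k)
         + 3 * ((11 * real k ^ 4 - 25 * real k ^ 2 + 14) / (180 * real k))
         + 6 * ((17 * real k ^ 6 - 56 * real k ^ 4 + 63 * real k ^ 2 - 24) / (420 * real k ^ 3))
         + 3 * ((11 * real k ^ 4 - 25 * real k ^ 2 + 14) / (180 * real k)))
        + (- 9 * ((real k ^ 2 - 1) / 6) - 24 * ((7 * real k ^ 4 - 15 * real k ^ 2 + 8) / (60 * real k ^ 2)) - 6 * m ^ 2) * m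
        + 26 * m ^ 3
      = 4 * (real k - 2) * (1 + 2 * real k) * (2 * real k - 1) * (real k + 2) * (real k - 1) * (real k + 1) / (945 * real k ^ 3)"
  unfolding assms(2) using assms(1)
  by (simp add: field_simps power_numeral_reduce)

section \<open>Boundedness and measurability\<close>

context prob_space
begin

text \<open>The law of a letter confines it to 1..k only almost surely, hence the almost-everywhere
  bound. The class is closed under sums and products and consists of integrable functions, which
  settles the integrability conditions below.\<close>

definition ess_bounded :: "('a \<Rightarrow> real) \<Rightarrow> bool" where
  "ess_bounded f \<longleftrightarrow> f \<in> borel_measurable M \<and> (\<exists>B. AE \<omega> in M. \<bar>f \<omega>\<bar> \<le> B)"

lemma ess_bounded_const: "ess_bounded (\<lambda>_. c)"
  by (auto simp: ess_bounded_def)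

lemma ess_bounded_add:
  assumes "ess_bounded f" "ess_bounded g"
  shows "ess_bounded (\<lambda>\<omega>. f \<omega> + g \<omega>)"
proof -
  obtain B C where "AE \<omega> in M. \<bar>f \<omega>\<bar> \<le> B" "AE \<omega> in M. \<bar>g \<omega>\<bar> \<le> C"
    using assms by (auto simp: ess_bounded_def)
  then have "AE \<omega> in M. \<bar>f \<omega> + g \<omega>\<bar> \<le> B + C"
    by eventually_elim simp
  with assms show ?thesis
    by (auto simp: ess_bounded_def)
qed

lemma ess_bounded_mult:
  assumes "ess_bounded f" "ess_bounded g"
  shows "ess_bounded (\<lambda>\<omega>. f \<omega> * g \<omega>)"
proof -
  obtain B C where "AE \<omega> in M. \<bar>f \<omega>\<bar> \<le> B" "AE \<omega> in M. \<bar>g \<omega>\<bar> \<le> C"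
    using assms by (auto simp: ess_bounded_def)
  then have "AE \<omega> in M. \<bar>f \<omega> * g \<omega>\<bar> \<le> B * C"
  proof eventually_elim
    case (elim \<omega>)
    then show ?case
      unfolding abs_mult by (intro mult_mono) auto
  qed
  with assms show ?thesis
    by (auto simp: ess_bounded_def)
qed

lemma ess_bounded_power:
  assumes "ess_bounded f"
  shows "ess_bounded (\<lambda>\<omega>. f \<omega> ^ n)"
  by (induct n) (simp_all add: ess_bounded_const ess_bounded_mult assms)

lemma ess_bounded_sum:
  assumes "\<And>i. i \<in> I \<Longrightarrow> ess_bounded (f i)"
  shows "ess_bounded (\<lambda>\<omega>. \<Sum>i\<in>I. f i \<omega>)"
  using assms
  by (induct I rule: infinite_finite_induct) (simp_all add: ess_bounded_const ess_bounded_add)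

lemma ess_bounded_integrable: "ess_bounded f \<Longrightarrow> integrable M f"
  by (auto simp: ess_bounded_def intro!: integrable_const_bound)

end

text \<open>Since the letters are countable, one coordinate can be fixed at each of its values in
  turn, so an arbitrary V is allowed. This makes functions of the past and of the future measurable
  on their product spaces.\<close>

lemma measurable_component_pair:
  fixes V :: "'b::countable \<Rightarrow> 'b \<Rightarrow> real"
  assumes "i \<in> A" "j \<in> A"
  shows "(\<lambda>f. V (f i) (f j)) \<in> borel_measurable (PiM A (\<lambda>_. count_space UNIV))"
proof (rule measurable_compose_countable[where f="\<lambda>a f. V a (f j)"])
  show "(\<lambda>f. f i) \<in> PiM A (\<lambda>_. count_space UNIV) \<rightarrow>\<^sub>M count_space UNIV"
    by (rule measurable_component_singleton[OF assms(1)])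
  fix a
  show "(\<lambda>f. V a (f j)) \<in> borel_measurable (PiM A (\<lambda>_. count_space UNIV))"
    by (rule measurable_compose[OF measurable_component_singleton[OF assms(2)]]) simp
qed

section \<open>Words with independent uniform letters\<close>

locale uniform_word = prob_space \<Omega> for \<Omega> :: "'a measure" +
  fixes k :: nat and x :: "nat \<Rightarrow> 'a \<Rightarrow> int"
  assumes k_pos: "k \<ge> 1"
    and indep: "indep_vars (\<lambda>_. count_space UNIV) x UNIV"
    and uniform: "\<And>i. distr \<Omega> (count_space UNIV) (x i) = measure_pmf (pmf_of_set {1..int k})"
begin

lemma letter_measurable [measurable]: "x i \<in> measurable \<Omega> (count_space UNIV)"
  using indep by (auto simp: indep_vars_def)

lemma AE_letters: "AE \<omega> in \<Omega>. \<forall>i. x i \<omega> \<in> {1..int k}"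
proof (subst AE_all_countable, intro allI)
  fix i
  have "AE a in measure_pmf (pmf_of_set {1..int k}). a \<in> {1..int k}"
    using k_pos by (simp add: AE_measure_pmf_iff)
  then show "AE \<omega> in \<Omega>. x i \<omega> \<in> {1..int k}"
    using AE_distrD[OF letter_measurable[of i], of "\<lambda>a. a \<in> {1..int k}"] unfolding uniform by blast
qed

lemma prob_letter:
  assumes "a \<in> {1..int k}"
  shows "prob (x i -` {a} \<inter> space \<Omega>) = 1 / real k"
proof -
  have "prob (x i -` {a} \<inter> space \<Omega>) = measure (distr \<Omega> (count_space UNIV) (x i)) {a}"
    by (subst measure_distr) auto
  also have "\<dots> = pmf (pmf_of_set {1..int k}) a"
    unfolding uniform by (simp add: measure_pmf_single)
  also have "\<dots> = 1 / real k"
    using assms k_pos by (subst pmf_of_set) auto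
  finally show ?thesis .
qed

lemma prob_four_letters:
  assumes "a \<in> {1..int k}" "b \<in> {1..int k}" "c \<in> {1..int k}" "d \<in> {1..int k}"
  shows "prob {\<omega>\<in>space \<Omega>. x i \<omega> = a \<and> x (i + 1) \<omega> = b \<and> x (i + 2) \<omega> = c \<and> x (i + 3) \<omega> = d} = 1 / real k ^ 4"
proof -
  \<comment> \<open>Collects the four prescribed values into one family, so that the event is an
    intersection over the index set and independence applies.\<close>
  define g where "g j = (if j = i then a else if j = i + 1 then b else if j = i + 2 then c else d)" for j
  let ?J = "{i, i + 1, i + 2, i + 3}"
  have "{\<omega>\<in>space \<Omega>. x i \<omega> = a \<and> x (i + 1) \<omega> = b \<and> x (i + 2) \<omega> = c \<and> x (i + 3) \<omega> = d}
      = (\<Inter>j\<in>?J. x j -` {g j} \<inter> space \<Omega>)"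
    by (auto simp: g_def)
  then have "prob {\<omega>\<in>space \<Omega>. x i \<omega> = a \<and> x (i + 1) \<omega> = b \<and> x (i + 2) \<omega> = c \<and> x (i + 3) \<omega> = d}
      = (\<Prod>j\<in>?J. prob (x j -` {g j} \<inter> space \<Omega>))"
    using indep_varsD[OF indep, of ?J "\<lambda>j. {g j}"] by simp
  also have "\<dots> = (\<Prod>j\<in>?J. 1 / real k)"
    using assms by (intro prod.cong refl prob_letter) (auto simp: g_def)
  finally show ?thesis
    by (simp add: power4_eq_xxxx)
qed

text \<open>The bridge from probability to finite sums: almost surely the integrand is a combination
  of indicators of the k^4 words, each of probability 1 / k^4. As the right side is free of i,
  stationarity is included.\<close>

lemma expectation_four_letters:
  "expectation (\<lambda>\<omega>. F (x i \<omega>) (x (i + 1) \<omega>) (x (i + 2) \<omega>) (x (i + 3) \<omega>)) = avg4 k F"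
proof -
  let ?P = "\<lambda>a b c d \<omega>. x i \<omega> = int a \<and> x (i + 1) \<omega> = int b \<and> x (i + 2) \<omega> = int c \<and> x (i + 3) \<omega> = int d"
  let ?G = "\<lambda>\<omega>. \<Sum>a=1..k. \<Sum>b=1..k. \<Sum>c=1..k. \<Sum>d=1..k.
      F (int a) (int b) (int c) (int d) * indicator {\<omega>\<in>space \<Omega>. ?P a b c d \<omega>} \<omega>"
  have meas: "{\<omega>\<in>space \<Omega>. ?P a b c d \<omega>} \<in> events" for a b c d
    by measurable
  have "expectation (\<lambda>\<omega>. F (x i \<omega>) (x (i + 1) \<omega>) (x (i + 2) \<omega>) (x (i + 3) \<omega>)) = expectation ?G"
  proof (rule integral_cong_AE)
    \<comment> \<open>Measurability for arbitrary F: constants are replaced by letters one at a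
      time, using countability.\<close>
    have "(\<lambda>\<omega>. F p q (x (i + 2) \<omega>) (x (i + 3) \<omega>)) \<in> borel_measurable \<Omega>" for p q
      by (rule measurable_compose_countable[where f="\<lambda>r \<omega>. F p q r (x (i + 3) \<omega>)"]) measurable
    then have "(\<lambda>\<omega>. F p (x (i + 1) \<omega>) (x (i + 2) \<omega>) (x (i + 3) \<omega>)) \<in> borel_measurable \<Omega>" for p
      by (rule measurable_compose_countable[where f="\<lambda>q \<omega>. F p q (x (i + 2) \<omega>) (x (i + 3) \<omega>)"]) measurable
    then show "(\<lambda>\<omega>. F (x i \<omega>) (x (i + 1) \<omega>) (x (i + 2) \<omega>) (x (i + 3) \<omega>)) \<in> borel_measurable \<Omega>"
      by (rule measurable_compose_countable[where f="\<lambda>p \<omega>. F p (x (i + 1) \<omega>) (x (i + 2) \<omega>) (x (i + 3) \<omega>)"]) measurable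
    show "?G \<in> borel_measurable \<Omega>"
      using meas by (intro borel_measurable_sum borel_measurable_times borel_measurable_const borel_measurable_indicator)
    show "AE \<omega> in \<Omega>. F (x i \<omega>) (x (i + 1) \<omega>) (x (i + 2) \<omega>) (x (i + 3) \<omega>) = ?G \<omega>"
      using AE_letters AE_space
    proof eventually_elim
      case (elim \<omega>)
      then have rng: "nat (x j \<omega>) \<in> {1..k}" and nat: "int (nat (x j \<omega>)) = x j \<omega>" for j
        by (smt (verit) atLeastAtMost_iff nat_le_iff nat_1 nat_mono One_nat_def nat_0_le)+
      have "?G \<omega> = (\<Sum>a=1..k. \<Sum>b=1..k. \<Sum>c=1..k. \<Sum>d=1..k. F (int a) (int b) (int c) (int d) *
          of_bool (nat (x i \<omega>) = a \<and> nat (x (i + 1) \<omega>) = b \<and> nat (x (i + 2) \<omega>) = c \<and> nat (x (i + 3) \<omega>) = d))"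
        using elim(2) nat
        by (intro sum.cong refl) (auto simp: indicator_def intro!: sum.cong)
      also have "\<dots> = F (x i \<omega>) (x (i + 1) \<omega>) (x (i + 2) \<omega>) (x (i + 3) \<omega>)"
        using rng by (subst sum4_delta) (simp_all only: nat finite_atLeastAtMost)
      finally show ?case ..
    qed
  qed
  also have "\<dots> = (\<Sum>a=1..k. \<Sum>b=1..k. \<Sum>c=1..k. \<Sum>d=1..k.
      F (int a) (int b) (int c) (int d) * prob {\<omega>\<in>space \<Omega>. ?P a b c d \<omega>})"
  proof -
    have int: "integrable \<Omega> (indicator {\<omega>\<in>space \<Omega>. ?P a b c d \<omega>} :: 'a \<Rightarrow> real)" for a b c d
      using meas by (intro integrable_real_indicator) (auto simp: emeasure_eq_measure)
    have "expectation (indicator {\<omega>\<in>space \<Omega>. ?P a b c d \<omega>}) = prob {\<omega>\<in>space \<Omega>. ?P a b c d \<omega>}" for a b c d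
      unfolding Bochner_Integration.integral_indicator by (intro arg_cong[where f=prob]) auto
    then show ?thesis
      using int by (simp only: Bochner_Integration.integral_sum Bochner_Integration.integrable_sum
          integral_mult_right_zero integrable_mult_right)
  qed
  also have "\<dots> = (\<Sum>a=1..k. \<Sum>b=1..k. \<Sum>c=1..k. \<Sum>d=1..k.
      F (int a) (int b) (int c) (int d) * (1 / real k ^ 4))"
    by (intro sum.cong refl arg_cong2[where f="(*)"] prob_four_letters) auto
  finally show ?thesis
    by (simp add: avg4_def sum_divide_distrib)
qed

section \<open>Centred partial sums and independence of past and future\<close>

definition mean_step :: real where
  "mean_step = avg4 k (\<lambda>a b c d. dist_letters a b)"

definition mean_letter :: real where
  "mean_letter = avg4 k (\<lambda>a b c d. of_int a)"

definition Z :: "int \<Rightarrow> int \<Rightarrow> real" where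
  "Z a b = dist_letters a b - mean_step"

definition W :: "int \<Rightarrow> real" where
  "W a = of_int a - mean_letter"

text \<open>The first letter is counted with the past, so the centred perimeter of n + 1 letters is
  \<open>S n\<close> plus the centred last letter. \<open>S n\<close> reads only the letters
  0..n.\<close>

definition S :: "nat \<Rightarrow> 'a \<Rightarrow> real" where
  "S n \<omega> = W (x 0 \<omega>) + (\<Sum>i=1..n. Z (x (i - 1) \<omega>) (x i \<omega>))"

lemma S_Suc: "S (Suc n) \<omega> = S n \<omega> + Z (x n \<omega>) (x (Suc n) \<omega>)"
  by (simp add: S_def)

lemma avg4_Z: "avg4 k (\<lambda>a b c d. Z a b) = 0"
  using k_pos by (simp add: Z_def avg4_diff avg4_const mean_step_def)

lemma avg4_W: "avg4 k (\<lambda>a b c d. W a) = 0"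
  using k_pos by (simp add: W_def avg4_diff avg4_const mean_letter_def)

lemma ess_bounded_letters: "ess_bounded (\<lambda>\<omega>. V (x i \<omega>) (x j \<omega>))"
proof -
  have "(\<lambda>\<omega>. V (x i \<omega>) (x j \<omega>)) \<in> borel_measurable \<Omega>"
    by (rule measurable_compose_countable[where f="\<lambda>a \<omega>. V a (x j \<omega>)"]) measurable
  \<comment> \<open>The sum of |V| over all pairs of letters dominates each single value.\<close>
  moreover have "AE \<omega> in \<Omega>. \<bar>V (x i \<omega>) (x j \<omega>)\<bar> \<le> (\<Sum>(a, b)\<in>{1..int k} \<times> {1..int k}. \<bar>V a b\<bar>)"
    using AE_letters
  proof eventually_elim
    case (elim \<omega>)
    then show ?case
      using member_le_sum[of "(x i \<omega>, x j \<omega>)" "{1..int k} \<times> {1..int k}" "\<lambda>(a, b). \<bar>V a b\<bar>"]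
      by auto
  qed
  ultimately show ?thesis
    by (auto simp: ess_bounded_def)
qed

lemma ess_bounded_S: "ess_bounded (S n)"
  unfolding S_def
  by (intro ess_bounded_add ess_bounded_sum ess_bounded_letters[of "\<lambda>a b. W a"] ess_bounded_letters)

lemmas ess_bounded_intros =
  ess_bounded_add ess_bounded_mult ess_bounded_power ess_bounded_const ess_bounded_S ess_bounded_letters

lemma expectation_S: "expectation (S n) = 0"
proof -
  have "expectation (\<lambda>\<omega>. Z (x i \<omega>) (x (Suc i) \<omega>)) = 0" for i
    using expectation_four_letters[of "\<lambda>a b c d. Z a b" i] avg4_Z by simp
  moreover have "expectation (\<lambda>\<omega>. W (x 0 \<omega>)) = 0"
    using expectation_four_letters[of "\<lambda>a b c d. W a" 0] avg4_W by simp
  ultimately show ?thesis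
  proof (induct n)
    case 0
    then show ?case
      by (simp add: S_def)
  next
    case (Suc n)
    then show ?case
      by (simp add: S_Suc[abs_def] ess_bounded_integrable ess_bounded_S ess_bounded_letters)
  qed
qed

text \<open>\<open>S n\<close> reads letters up to n, while G and H read letters from n + 1 on. The
  product form of the future covers two adjacent steps, and also a single one by taking H =
  1.\<close>

lemma past_future_independent:
  "expectation (\<lambda>\<omega>. S n \<omega> ^ p * G (x (n + 1) \<omega>) (x (n + 2) \<omega>) * H (x (n + 2) \<omega>) (x (n + 3) \<omega>))
    = expectation (\<lambda>\<omega>. S n \<omega> ^ p) * expectation (\<lambda>\<omega>. G (x (n + 1) \<omega>) (x (n + 2) \<omega>) * H (x (n + 2) \<omega>) (x (n + 3) \<omega>))"
proof -
  let ?L = "count_space UNIV :: int measure"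
  let ?past = "\<lambda>f :: nat \<Rightarrow> int. (W (f 0) + (\<Sum>i=1..n. Z (f (i - 1)) (f i))) ^ p"
  let ?future = "\<lambda>f :: nat \<Rightarrow> int. G (f (n + 1)) (f (n + 2)) * H (f (n + 2)) (f (n + 3))"
  have "indep_var (PiM {..n} (\<lambda>_. ?L)) (\<lambda>\<omega>. restrict (\<lambda>i. x i \<omega>) {..n})
      (PiM {n<..} (\<lambda>_. ?L)) (\<lambda>\<omega>. restrict (\<lambda>i. x i \<omega>) {n<..})"
    by (rule indep_var_restrict[OF indep]) auto
  moreover have "?past \<in> borel_measurable (PiM {..n} (\<lambda>_. ?L))"
    by (intro borel_measurable_power borel_measurable_add borel_measurable_sum
        measurable_component_pair measurable_component_pair[where V="\<lambda>a b. W a"]) auto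
  moreover have "?future \<in> borel_measurable (PiM {n<..} (\<lambda>_. ?L))"
    by (intro borel_measurable_times measurable_component_pair) auto
  ultimately have "indep_var borel (?past \<circ> (\<lambda>\<omega>. restrict (\<lambda>i. x i \<omega>) {..n}))
      borel (?future \<circ> (\<lambda>\<omega>. restrict (\<lambda>i. x i \<omega>) {n<..}))"
    by (rule indep_var_compose)
  moreover have "?past \<circ> (\<lambda>\<omega>. restrict (\<lambda>i. x i \<omega>) {..n}) = (\<lambda>\<omega>. S n \<omega> ^ p)"
    by (auto simp: S_def fun_eq_iff le_diff_conv intro!: arg_cong[where f="\<lambda>t. t ^ p"] sum.cong)
  moreover have "?future \<circ> (\<lambda>\<omega>. restrict (\<lambda>i. x i \<omega>) {n<..})
      = (\<lambda>\<omega>. G (x (n + 1) \<omega>) (x (n + 2) \<omega>) * H (x (n + 2) \<omega>) (x (n + 3) \<omega>))"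
    by (auto simp: fun_eq_iff)
  ultimately have ind: "indep_var borel (\<lambda>\<omega>. S n \<omega> ^ p)
      borel (\<lambda>\<omega>. G (x (n + 1) \<omega>) (x (n + 2) \<omega>) * H (x (n + 2) \<omega>) (x (n + 3) \<omega>))"
    by simp
  show ?thesis
    unfolding mult.assoc
    by (rule indep_var_lebesgue_integral[OF ind]) (intro ess_bounded_integrable ess_bounded_intros)+
qed

section \<open>Growth of the third moment\<close>

definition cube_increment :: "(int \<Rightarrow> int \<Rightarrow> real) \<Rightarrow> real" where
  "cube_increment V = avg4 k (\<lambda>a b c d. V a b ^ 3)
     + 3 * avg4 k (\<lambda>a b c d. Z a b * V b c ^ 2)
     + 3 * avg4 k (\<lambda>a b c d. Z a b ^ 2 * V b c)
     + 6 * avg4 k (\<lambda>a b c d. Z a b * Z b c * V c d)"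

text \<open>Let z1 and z2 be the last two steps in \<open>S (m + 2)\<close> and v the new term.
  \<open>S (m + 1)\<close> shares no letter with v, and \<open>S m\<close> none with z2 and v. So
  the terms \<open>S (m + 1)\<close>^2 v, \<open>S (m + 1)\<close> v^2 and \<open>S m\<close> z2 v
  factor and vanish, the first because v is centred, the other two because the past is. The
  remaining terms have the coefficients of \<open>cube_increment\<close>.\<close>

lemma expectation_cube_add:
  assumes V: "avg4 k (\<lambda>a b c d. V a b) = 0"
  shows "expectation (\<lambda>\<omega>. (S (m + 2) \<omega> + V (x (m + 2) \<omega>) (x (m + 3) \<omega>)) ^ 3)
    = expectation (\<lambda>\<omega>. S (m + 2) \<omega> ^ 3) + cube_increment V"
proof -
  let ?z1 = "\<lambda>\<omega>. Z (x m \<omega>) (x (m + 1) \<omega>)" and ?z2 = "\<lambda>\<omega>. Z (x (m + 1) \<omega>) (x (m + 2) \<omega>)"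
    and ?v = "\<lambda>\<omega>. V (x (m + 2) \<omega>) (x (m + 3) \<omega>)"
  have S1: "S (m + 1) \<omega> = S m \<omega> + ?z1 \<omega>" and S2: "S (m + 2) \<omega> = S (m + 1) \<omega> + ?z2 \<omega>" for \<omega>
    by (simp_all add: S_Suc)
  (* The powers ^ 1 and factors 1 match the shape of past_future_independent. *)
  have expand: "(S (m + 2) \<omega> + ?v \<omega>) ^ 3 = S (m + 2) \<omega> ^ 3 + 3 * (S (m + 1) \<omega> ^ 2 * 1 * ?v \<omega>)
      + 6 * (S m \<omega> ^ 1 * ?z2 \<omega> * ?v \<omega>) + 6 * (?z1 \<omega> * ?z2 \<omega> * ?v \<omega>) + 3 * (?z2 \<omega> ^ 2 * ?v \<omega>)
      + 3 * (S (m + 1) \<omega> ^ 1 * 1 * ?v \<omega> ^ 2) + 3 * (?z2 \<omega> * ?v \<omega> ^ 2) + ?v \<omega> ^ 3" for \<omega>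
    unfolding S2 S1 by algebra
  have v: "expectation ?v = 0"
    using expectation_four_letters[of "\<lambda>a b c d. V a b" "m + 2"] V by (simp add: numeral_eq_Suc)
  have S0: "expectation (\<lambda>\<omega>. S n \<omega> ^ 1) = 0" for n
    by (simp add: expectation_S)
  have past: "expectation (\<lambda>\<omega>. S (m + 1) \<omega> ^ 2 * 1 * ?v \<omega>) = 0"
      "expectation (\<lambda>\<omega>. S m \<omega> ^ 1 * ?z2 \<omega> * ?v \<omega>) = 0"
      "expectation (\<lambda>\<omega>. S (m + 1) \<omega> ^ 1 * 1 * ?v \<omega> ^ 2) = 0"
    using past_future_independent[of "m + 1" 2 V "\<lambda>_ _. 1"] v
      past_future_independent[of m 1 Z V, unfolded S0]
      past_future_independent[of "m + 1" 1 "\<lambda>a b. V a b ^ 2" "\<lambda>_ _. 1", unfolded S0]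
    by (simp_all add: numeral_eq_Suc)
  have future: "expectation (\<lambda>\<omega>. ?z1 \<omega> * ?z2 \<omega> * ?v \<omega>) = avg4 k (\<lambda>a b c d. Z a b * Z b c * V c d)"
      "expectation (\<lambda>\<omega>. ?z2 \<omega> ^ 2 * ?v \<omega>) = avg4 k (\<lambda>a b c d. Z a b ^ 2 * V b c)"
      "expectation (\<lambda>\<omega>. ?z2 \<omega> * ?v \<omega> ^ 2) = avg4 k (\<lambda>a b c d. Z a b * V b c ^ 2)"
      "expectation (\<lambda>\<omega>. ?v \<omega> ^ 3) = avg4 k (\<lambda>a b c d. V a b ^ 3)"
    using expectation_four_letters[of "\<lambda>a b c d. Z a b * Z b c * V c d" m]
      expectation_four_letters[of "\<lambda>a b c d. Z a b ^ 2 * V b c" "m + 1"]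
      expectation_four_letters[of "\<lambda>a b c d. Z a b * V b c ^ 2" "m + 1"]
      expectation_four_letters[of "\<lambda>a b c d. V a b ^ 3" "m + 2"]
    by (simp_all add: numeral_eq_Suc)
  have "expectation (\<lambda>\<omega>. (S (m + 2) \<omega> + ?v \<omega>) ^ 3)
      = expectation (\<lambda>\<omega>. S (m + 2) \<omega> ^ 3) + 3 * expectation (\<lambda>\<omega>. S (m + 1) \<omega> ^ 2 * 1 * ?v \<omega>)
      + 6 * expectation (\<lambda>\<omega>. S m \<omega> ^ 1 * ?z2 \<omega> * ?v \<omega>) + 6 * expectation (\<lambda>\<omega>. ?z1 \<omega> * ?z2 \<omega> * ?v \<omega>)
      + 3 * expectation (\<lambda>\<omega>. ?z2 \<omega> ^ 2 * ?v \<omega>) + 3 * expectation (\<lambda>\<omega>. S (m + 1) \<omega> ^ 1 * 1 * ?v \<omega> ^ 2)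
      + 3 * expectation (\<lambda>\<omega>. ?z2 \<omega> * ?v \<omega> ^ 2) + expectation (\<lambda>\<omega>. ?v \<omega> ^ 3)"
  proof -
    have "integrable \<Omega> (\<lambda>\<omega>. S (m + 2) \<omega> ^ 3)" "integrable \<Omega> (\<lambda>\<omega>. S (m + 1) \<omega> ^ 2 * 1 * ?v \<omega>)"
      "integrable \<Omega> (\<lambda>\<omega>. S m \<omega> ^ 1 * ?z2 \<omega> * ?v \<omega>)" "integrable \<Omega> (\<lambda>\<omega>. ?z1 \<omega> * ?z2 \<omega> * ?v \<omega>)"
      "integrable \<Omega> (\<lambda>\<omega>. ?z2 \<omega> ^ 2 * ?v \<omega>)" "integrable \<Omega> (\<lambda>\<omega>. S (m + 1) \<omega> ^ 1 * 1 * ?v \<omega> ^ 2)"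
      "integrable \<Omega> (\<lambda>\<omega>. ?z2 \<omega> * ?v \<omega> ^ 2)" "integrable \<Omega> (\<lambda>\<omega>. ?v \<omega> ^ 3)"
      by (intro ess_bounded_integrable ess_bounded_intros)+
    then show ?thesis
      unfolding expand by (simp only: Bochner_Integration.integral_add Bochner_Integration.integrable_add
          integral_mult_right_zero integrable_mult_right)
  qed
  then show ?thesis
    unfolding past future cube_increment_def by simp
qed

text \<open>Iterates the increment with V = \<open>Z\<close>. The base is \<open>S 2\<close> because
  \<open>expectation_cube_add\<close> peels two steps off the sum.\<close>

lemma expectation_cube_S:
  "expectation (\<lambda>\<omega>. S (m + 2) \<omega> ^ 3) = expectation (\<lambda>\<omega>. S 2 \<omega> ^ 3) + real m * cube_increment Z"
proof (induct m)
  case (Suc m)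
  have "S (Suc m + 2) \<omega> = S (m + 2) \<omega> + Z (x (m + 2) \<omega>) (x (m + 3) \<omega>)" for \<omega>
    using S_Suc[of "m + 2"] by (simp add: numeral_eq_Suc)
  then show ?case
    using expectation_cube_add[of Z m] Suc avg4_Z by (simp add: algebra_simps)
qed (simp add: numeral_2_eq_2)

text \<open>The last letter acts as one more centred term, a V that ignores its second argument, so
  the same increment lemma handles the boundary.\<close>

lemma third_central_moment_perimeter:
  "third_central_moment \<Omega> (perimeter x (m + 3))
    = expectation (\<lambda>\<omega>. S 2 \<omega> ^ 3) + real m * cube_increment Z + cube_increment (\<lambda>a b. W a)"
proof -
  \<comment> \<open>The mean perimeter of m + 3 letters: two end letters, m + 2 steps, and 2 per
    letter.\<close>
  define C where "C = 2 * mean_letter + real (m + 2) * mean_step + 2 * real (m + 3)"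
  have decomp: "real_of_int (perimeter x (m + 3) \<omega>) = S (m + 2) \<omega> + W (x (m + 2) \<omega>) + C" for \<omega>
    by (simp add: perimeter_def step_def S_def W_def Z_def C_def sum_subtractf del: One_nat_def)
  have "expectation (\<lambda>\<omega>. W (x (m + 2) \<omega>)) = 0"
    using expectation_four_letters[of "\<lambda>a b c d. W a" "m + 2"] avg4_W by simp
  then have "expectation (\<lambda>\<omega>. real_of_int (perimeter x (m + 3) \<omega>)) = C"
    using ess_bounded_integrable[OF ess_bounded_S[of "m + 2"]]
      ess_bounded_integrable[OF ess_bounded_letters[of "\<lambda>a b. W a" "m + 2" 0]]
    by (simp add: decomp expectation_S prob_space)
  then have "third_central_moment \<Omega> (perimeter x (m + 3))
      = expectation (\<lambda>\<omega>. (S (m + 2) \<omega> + W (x (m + 2) \<omega>)) ^ 3)"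
    by (simp add: third_central_moment_def decomp)
  then show ?thesis
    using expectation_cube_add[of "\<lambda>a b. W a" m] avg4_W expectation_cube_S[of m] by simp
qed

section \<open>Identification and evaluation of the slope\<close>

lemma mu3_star_avg4:
  "mu3_star \<Omega> x =
    (avg4 k (\<lambda>a b c d. dist_letters a b ^ 3) + 3 * avg4 k (\<lambda>a b c d. dist_letters a b * dist_letters b c ^ 2)
      + 6 * avg4 k (\<lambda>a b c d. dist_letters a b * dist_letters b c * dist_letters c d)
      + 3 * avg4 k (\<lambda>a b c d. dist_letters a b ^ 2 * dist_letters b c))
    + (- 9 * avg4 k (\<lambda>a b c d. dist_letters a b ^ 2)
       - 24 * avg4 k (\<lambda>a b c d. dist_letters a b * dist_letters b c) - 6 * mean_step ^ 2) * mean_step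
    + 26 * mean_step ^ 3"
proof -
  \<comment> \<open>The indices keep the form 0 + j to match \<open>expectation_four_letters\<close>
    at i = 0 syntactically.\<close>
  have steps: "step x 1 \<omega> = \<bar>x (0 + 1) \<omega> - x 0 \<omega>\<bar>" "step x 2 \<omega> = \<bar>x (0 + 2) \<omega> - x (0 + 1) \<omega>\<bar>"
    "step x 3 \<omega> = \<bar>x (0 + 3) \<omega> - x (0 + 2) \<omega>\<bar>" for \<omega>
    by (simp_all add: step_def numeral_eq_Suc)
  note letters = expectation_four_letters[where i = 0]
  show ?thesis
    unfolding mu3_star_def Let_def steps mean_step_def
      letters[of "\<lambda>a b c d. dist_letters a b"] letters[of "\<lambda>a b c d. dist_letters a b ^ 2"]
      letters[of "\<lambda>a b c d. dist_letters a b ^ 3"] letters[of "\<lambda>a b c d. dist_letters a b * dist_letters b c"]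
      letters[of "\<lambda>a b c d. dist_letters a b * dist_letters b c ^ 2"]
      letters[of "\<lambda>a b c d. dist_letters a b ^ 2 * dist_letters b c"]
      letters[of "\<lambda>a b c d. dist_letters a b * dist_letters b c * dist_letters c d"]
    by (rule refl)
qed

text \<open>Each centred moment is expanded into raw moments, and shifted copies are identified by
  \<open>avg4_shift\<close>. Weighting the four expansions by 1, 3, 3 and 6 yields the coefficients
  -9 and -24.\<close>

lemma cube_increment_Z: "cube_increment Z = mu3_star \<Omega> x"
proof -
  define d where "d a b = dist_letters a b" for a b
  define m where "m = mean_step"
  let ?A = "avg4 k"
  note lin = avg4_add avg4_diff avg4_cmult avg4_const[OF k_pos]
  have mean: "?A (\<lambda>a b c e. d a b) = m" "?A (\<lambda>a b c e. d b c) = m" "?A (\<lambda>a b c e. d c e) = m"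
    using avg4_shift[of k "\<lambda>a b c. d a b"] avg4_shift[of k "\<lambda>a b c. d b c"]
    by (simp_all add: d_def m_def mean_step_def)
  have sq: "?A (\<lambda>a b c e. d b c ^ 2) = ?A (\<lambda>a b c e. d a b ^ 2)"
    using avg4_shift[of k "\<lambda>a b c. d a b ^ 2"] .
  have adjacent: "?A (\<lambda>a b c e. d b c * d c e) = ?A (\<lambda>a b c e. d a b * d b c)"
    using avg4_shift[of k "\<lambda>a b c. d a b * d b c"] .
  \<comment> \<open>The first and third steps share no letter. This pair is the source of the term -
    6 M^2 in the slope; the other cubes of the mean add up to 26 M^3.\<close>
  have disjoint: "?A (\<lambda>a b c e. d a b * d c e) = m ^ 2"
  proof -
    have "?A (\<lambda>a b c e. d a b * d c e) = ?A (\<lambda>a b c e. d a b) * ?A (\<lambda>a b c e. d a b)"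
      using k_pos
      by (simp add: avg4_def field_simps power_numeral_reduce flip: sum_distrib_left sum_distrib_right)
    then show ?thesis
      by (simp add: mean power2_eq_square)
  qed
  have cube: "?A (\<lambda>a b c e. (d a b - m) ^ 3) = ?A (\<lambda>a b c e. d a b ^ 3) - 3 * m * ?A (\<lambda>a b c e. d a b ^ 2) + 2 * m ^ 3"
  proof -
    have eq: "(d a b - m) ^ 3 = d a b ^ 3 - (3 * m) * d a b ^ 2 + (3 * m ^ 2) * d a b - m ^ 3" for a b
      by algebra
    show ?thesis
      unfolding eq lin mean by algebra
  qed
  have one_two: "?A (\<lambda>a b c e. (d a b - m) * (d b c - m) ^ 2) = ?A (\<lambda>a b c e. d a b * d b c ^ 2)
      - 2 * m * ?A (\<lambda>a b c e. d a b * d b c) - m * ?A (\<lambda>a b c e. d a b ^ 2) + 2 * m ^ 3"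
  proof -
    have eq: "(d a b - m) * (d b c - m) ^ 2 = d a b * d b c ^ 2 - (2 * m) * (d a b * d b c) + m ^ 2 * d a b
        - m * d b c ^ 2 + (2 * m ^ 2) * d b c - m ^ 3" for a b c
      by algebra
    show ?thesis
      unfolding eq lin mean sq by algebra
  qed
  have two_one: "?A (\<lambda>a b c e. (d a b - m) ^ 2 * (d b c - m)) = ?A (\<lambda>a b c e. d a b ^ 2 * d b c)
      - 2 * m * ?A (\<lambda>a b c e. d a b * d b c) - m * ?A (\<lambda>a b c e. d a b ^ 2) + 2 * m ^ 3"
  proof -
    have eq: "(d a b - m) ^ 2 * (d b c - m) = d a b ^ 2 * d b c - (2 * m) * (d a b * d b c) + m ^ 2 * d b c
        - m * d a b ^ 2 + (2 * m ^ 2) * d a b - m ^ 3" for a b c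
      by algebra
    show ?thesis
      unfolding eq lin mean by algebra
  qed
  have ones: "?A (\<lambda>a b c e. (d a b - m) * (d b c - m) * (d c e - m)) = ?A (\<lambda>a b c e. d a b * d b c * d c e)
      - 2 * m * ?A (\<lambda>a b c e. d a b * d b c) + m ^ 3"
  proof -
    have eq: "(d a b - m) * (d b c - m) * (d c e - m) = d a b * d b c * d c e - m * (d a b * d b c) - m * (d b c * d c e)
        - m * (d a b * d c e) + m ^ 2 * d a b + m ^ 2 * d b c + m ^ 2 * d c e - m ^ 3" for a b c e
      by algebra
    show ?thesis
      unfolding eq lin mean adjacent disjoint by algebra
  qed
  have Z: "Z = (\<lambda>a b. d a b - m)"
    by (intro ext) (simp add: Z_def d_def m_def)
  show ?thesis
    unfolding cube_increment_def mu3_star_avg4 Z m_def[symmetric] d_def[symmetric] cube one_two two_one ones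
    by (simp add: algebra_simps power2_eq_square power3_eq_cube)
qed

lemma mu3_star_eq:
  "mu3_star \<Omega> x =
    4 * (real k - 2) * (1 + 2 * real k) * (2 * real k - 1) * (real k + 2) * (real k - 1) * (real k + 1)
      / (945 * real k ^ 3)"
  unfolding mu3_star_avg4
    avg4_step_power3[OF k_pos] avg4_step_power2[OF k_pos] avg4_step_step[OF k_pos]
    avg4_step_step2[OF k_pos] avg4_step_step_step[OF k_pos]
  by (rule mu3_closed_form[OF k_pos avg4_step[OF k_pos, folded mean_step_def]])

lemma third_central_moment_asymp:
  "(\<lambda>n. third_central_moment \<Omega> (perimeter x n) - real n * mu3_star \<Omega> x) \<in> O(\<lambda>_. 1)"
proof -
  \<comment> \<open>The exact value of the difference for all n \<ge> 3; the last term comes from n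
    = m + 3.\<close>
  define C where "C = expectation (\<lambda>\<omega>. S 2 \<omega> ^ 3) + cube_increment (\<lambda>a b. W a) - 3 * mu3_star \<Omega> x"
  have "third_central_moment \<Omega> (perimeter x n) - real n * mu3_star \<Omega> x = C" if "n \<ge> 3" for n
  proof -
    from that obtain m where "n = m + 3"
      by (auto simp: le_iff_add add.commute)
    then show ?thesis
      by (simp add: third_central_moment_perimeter cube_increment_Z C_def algebra_simps)
  qed
  then have "(\<lambda>n. third_central_moment \<Omega> (perimeter x n) - real n * mu3_star \<Omega> x) \<in> \<Theta>(\<lambda>_. C)"
    by (intro bigthetaI_cong eventually_sequentiallyI[of 3])
  also have "(\<lambda>_. C) \<in> O(\<lambda>_. 1)"
    by simp
  finally show ?thesis .
qed

end

theorem theorem3p1: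
  fixes k :: nat and \<Omega> :: "'a measure" and x :: "nat \<Rightarrow> 'a \<Rightarrow> int"
  assumes k: "k \<ge> 1"
    and space: "prob_space \<Omega>"
    and indep: "prob_space.indep_vars \<Omega> (\<lambda>_. count_space UNIV) x UNIV"
    and uniform: "\<And>i. distr \<Omega> (count_space UNIV) (x i) = measure_pmf (pmf_of_set {1..int k})"
  shows "(\<lambda>n. third_central_moment \<Omega> (perimeter x n) - real n * mu3_star \<Omega> x) \<in> O(\<lambda>_. 1)
    \<and> mu3_star \<Omega> x =
        4 * (real k - 2) * (1 + 2 * real k) * (2 * real k - 1) * (real k + 2) * (real k - 1) * (real k + 1)
          / (945 * real k ^ 3)"
proof -
  interpret uniform_word \<Omega> k x
    using assms by (simp add: uniform_word_def uniform_word_axioms_def)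
  show ?thesis
    using third_central_moment_asymp mu3_star_eq by blast
qed

end
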